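(* Let $M^{2n+1}(\varphi,Q,\xi,\eta,g)$, $n>0$, be a weak almost contact metric manifold with Levi-Civita connection $\nabla$ of $g$, and set $\widetilde Q=Q-\mathrm{id}_{TM}$. Suppose that $$(\nabla_X\varphi)Y=g(X,Y)\,\xi-\eta(Y)X\quad\text{for all } X,Y\in\mathfrak X_M,$$ and $$(\nabla_X\widetilde Q)Y=0\quad\text{for all } X\in\mathfrak X_M \text{ and all } Y\in\ker\eta.$$ Then $Q=\mathrm{id}_{TM}$ and the structure $(\varphi,\xi,\eta,g)$ is Sasakian.
   Context: $\mathfrak X_M$ is the space of smooth vector fields on $M$; "$Y\in\ker\eta$" means $Y$ is a vector field with $\eta(Y)=0$. A weak almost contact metric structure on a smooth manifold $M^{2n+1}$ ($n>0$) is a tuple $(\varphi,Q,\xi,\eta,g)$, where $\varphi$ is a $(1,1)$-tensor, $\xi$ a vector field, $\eta$ a 1-form with $\eta(\xi)=1$, $g$ a Riemannian metric, and $Q$ a nonsingular $(1,1)$-tensor, with $$g(\varphi X,\varphi Y)=g(X,QY)-\eta(X)\eta(Y),\quad X,Y\in\mathfrak X_M,$$ where the distribution $\ker\eta$ is assumed $\varphi$-invariant. For such a structure the following hold and are in force: $\varphi\xi=0$, $\eta\circ\varphi=0$, $\eta\circ Q=\eta$, $Q\varphi=\varphi Q$, $\varphi$ is skew-symmetric and $Q$ is self-adjoint and positive definite with respect to $g$, and $\eta(X)=g(\xi,X)$. (Hence $\varphi^2=-Q+\eta\otimes\xi$ and $Q\xi=\xi$.) When $Q=\mathrm{id}_{TM}$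 this is an almost contact metric structure $(\varphi,\xi,\eta,g)$. An almost contact metric structure $(\varphi,\xi,\eta,g)$ is Sasakian if it is contact metric, i.e. $d\eta(X,Y)=g(X,\varphi Y)$ for all $X,Y$, where $d\eta(X,Y)=\frac12\{X(\eta(Y))-Y(\eta(X))-\eta([X,Y])\}$, and the tensor $[\varphi,\varphi]+2\,d\eta\otimes\xi$ vanishes identically, where $[\varphi,\varphi](X,Y)=\varphi^2[X,Y]+[\varphi X,\varphi Y]-\varphi[\varphi X,Y]-\varphi[X,\varphi Y]$. *)

theory Defs
  imports "HOL-Analysis.Analysis" "HOL-Library.Function_Algebras"
begin

section \<open>Smooth manifolds\<close>

text \<open>Only used for open \<open>S\<close>, so that the derivative at a point of \<open>S\<close> depends on the values of
  the function on \<open>S\<close> alone.\<close>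

primrec Ck_on :: "nat \<Rightarrow> 'a::real_normed_vector set \<Rightarrow> ('a \<Rightarrow> 'b::real_normed_vector) \<Rightarrow> bool" where
  "Ck_on 0 S f \<longleftrightarrow> continuous_on S f"
| "Ck_on (Suc k) S f \<longleftrightarrow> (\<forall>x\<in>S. f differentiable (at x)) \<and>
     (\<forall>v. Ck_on k S (\<lambda>x. frechet_derivative f (at x) v))"

definition smooth_on :: "'a::real_normed_vector set \<Rightarrow> ('a \<Rightarrow> 'b::real_normed_vector) \<Rightarrow> bool" where
  "smooth_on S f \<longleftrightarrow> (\<forall>k. Ck_on k S f)"

text \<open>The points of the manifold are all elements of the type \<open>'m\<close>. A chart is a pair \<open>(U, x)\<close> of
  its domain and its coordinate map; the values of \<open>x\<close> outside \<open>U\<close> are irrelevant.\<close>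

type_synonym ('m, 'e) chart = "'m set \<times> ('m \<Rightarrow> 'e)"

definition is_chart :: "('m::topological_space, 'e::euclidean_space) chart \<Rightarrow> bool" where
  "is_chart = (\<lambda>(U, x). open U \<and> open (x ` U) \<and> homeomorphism U (x ` U) x (inv_into U x))"

definition smooth_atlas ::
  "('m::{t2_space, second_countable_topology}, 'e::euclidean_space) chart set \<Rightarrow> bool" where
  "smooth_atlas A \<longleftrightarrow> (\<forall>c\<in>A. is_chart c) \<and> (\<Union>(U, x)\<in>A. U) = UNIV \<and>
     (\<forall>(U, x)\<in>A. \<forall>(V, y)\<in>A. smooth_on (x ` (U \<inter> V)) (y \<circ> inv_into U x))"

definition smooth_functions ::
  "('m::topological_space, 'e::euclidean_space) chart set \<Rightarrow> ('m \<Rightarrow> real) set" where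
  "smooth_functions A = {f. \<forall>(U, x)\<in>A. smooth_on (x ` U) (f \<circ> inv_into U x)}"

section \<open>Vector fields\<close>

text \<open>Tangent vectors at \<open>p\<close> are the derivations at \<open>p\<close> of the algebra of smooth functions. They are
  set to \<open>0\<close> on functions that are not smooth, so that equality of tangent vectors is equality in HOL.\<close>

definition tangent_space ::
  "('m::topological_space, 'e::euclidean_space) chart set \<Rightarrow> 'm \<Rightarrow> (('m \<Rightarrow> real) \<Rightarrow> real) set" where
  "tangent_space A p = {v.
     (\<forall>f\<in>smooth_functions A. \<forall>h\<in>smooth_functions A. v (f + h) = v f + v h) \<and>
     (\<forall>c. \<forall>f\<in>smooth_functions A. v (\<lambda>q. c * f q) = c * v f) \<and>
     (\<forall>f\<in>smooth_functions A. \<forall>h\<in>smooth_functions A. v (f * h) = f p * v h + h p * v f) \<and>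
     (\<forall>f. f \<notin> smooth_functions A \<longrightarrow> v f = 0)}"

text \<open>A vector field assigns a tangent vector to each point. Addition, subtraction and \<open>0\<close> of vector
  fields and of functions are the pointwise ones.\<close>

type_synonym 'm vfield = "'m \<Rightarrow> ('m \<Rightarrow> real) \<Rightarrow> real"

definition vector_fields ::
  "('m::topological_space, 'e::euclidean_space) chart set \<Rightarrow> 'm vfield set" where
  "vector_fields A = {X. (\<forall>p. X p \<in> tangent_space A p) \<and>
     (\<forall>f\<in>smooth_functions A. (\<lambda>p. X p f) \<in> smooth_functions A)}"

definition fscale :: "('m \<Rightarrow> real) \<Rightarrow> 'm vfield \<Rightarrow> 'm vfield" (infixr "\<cdot>" 75) where
  "f \<cdot> X = (\<lambda>p h. f p * X p h)"

definition act :: "'m vfield \<Rightarrow> ('m \<Rightarrow> real) \<Rightarrow> 'm \<Rightarrow> real" where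
  "act X f = (\<lambda>p. X p f)"

definition lie_bracket :: "'m vfield \<Rightarrow> 'm vfield \<Rightarrow> 'm vfield" where
  "lie_bracket X Y = (\<lambda>p f. X p (act Y f) - Y p (act X f))"

section \<open>Tensor fields, Riemannian metrics and connections\<close>

text \<open>Tensor fields are maps on vector fields that are multilinear over the smooth functions.
  Such maps, and connections, are HOL functions on all of \<open>'m vfield\<close>; only their values on
  \<open>vector_fields A\<close> are meaningful.\<close>

definition one_form :: "('m::topological_space, 'e::euclidean_space) chart set \<Rightarrow>
    ('m vfield \<Rightarrow> 'm \<Rightarrow> real) \<Rightarrow> bool" where
  "one_form A \<eta> \<longleftrightarrow>
     (\<forall>X\<in>vector_fields A. \<eta> X \<in> smooth_functions A) \<and>
     (\<forall>X\<in>vector_fields A. \<forall>Y\<in>vector_fields A. \<eta> (X + Y) = \<eta> X + \<eta> Y) \<and>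
     (\<forall>f\<in>smooth_functions A. \<forall>X\<in>vector_fields A. \<eta> (f \<cdot> X) = f * \<eta> X)"

definition tensor11 :: "('m::topological_space, 'e::euclidean_space) chart set \<Rightarrow>
    ('m vfield \<Rightarrow> 'm vfield) \<Rightarrow> bool" where
  "tensor11 A F \<longleftrightarrow>
     (\<forall>X\<in>vector_fields A. F X \<in> vector_fields A) \<and>
     (\<forall>X\<in>vector_fields A. \<forall>Y\<in>vector_fields A. F (X + Y) = F X + F Y) \<and>
     (\<forall>f\<in>smooth_functions A. \<forall>X\<in>vector_fields A. F (f \<cdot> X) = f \<cdot> F X)"

definition riemannian_metric :: "('m::topological_space, 'e::euclidean_space) chart set \<Rightarrow>
    ('m vfield \<Rightarrow> 'm vfield \<Rightarrow> 'm \<Rightarrow> real) \<Rightarrow> bool" where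
  "riemannian_metric A g \<longleftrightarrow>
     (\<forall>X\<in>vector_fields A. one_form A (g X)) \<and>
     (\<forall>X\<in>vector_fields A. \<forall>Y\<in>vector_fields A. g X Y = g Y X) \<and>
     (\<forall>X\<in>vector_fields A. \<forall>p. X p \<noteq> 0 \<longrightarrow> g X X p > 0)"

definition connection :: "('m::topological_space, 'e::euclidean_space) chart set \<Rightarrow>
    ('m vfield \<Rightarrow> 'm vfield \<Rightarrow> 'm vfield) \<Rightarrow> bool" where
  "connection A D \<longleftrightarrow>
     (\<forall>Y\<in>vector_fields A. tensor11 A (\<lambda>X. D X Y)) \<and>
     (\<forall>X\<in>vector_fields A. \<forall>Y\<in>vector_fields A. \<forall>Z\<in>vector_fields A.
        D X (Y + Z) = D X Y + D X Z) \<and>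
     (\<forall>f\<in>smooth_functions A. \<forall>X\<in>vector_fields A. \<forall>Y\<in>vector_fields A.
        D X (f \<cdot> Y) = act X f \<cdot> Y + f \<cdot> D X Y)"

definition levi_civita :: "('m::topological_space, 'e::euclidean_space) chart set \<Rightarrow>
    ('m vfield \<Rightarrow> 'm vfield \<Rightarrow> 'm \<Rightarrow> real) \<Rightarrow> ('m vfield \<Rightarrow> 'm vfield \<Rightarrow> 'm vfield) \<Rightarrow> bool" where
  "levi_civita A g D \<longleftrightarrow> connection A D \<and>
     (\<forall>X\<in>vector_fields A. \<forall>Y\<in>vector_fields A. D X Y - D Y X = lie_bracket X Y) \<and>
     (\<forall>X\<in>vector_fields A. \<forall>Y\<in>vector_fields A. \<forall>Z\<in>vector_fields A.
        act X (g Y Z) = g (D X Y) Z + g Y (D X Z))"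

text \<open>\<open>cov_deriv11 D F X Y\<close> is \<open>(\<nabla>\<^sub>X F) Y\<close>.\<close>

definition cov_deriv11 :: "('m vfield \<Rightarrow> 'm vfield \<Rightarrow> 'm vfield) \<Rightarrow> ('m vfield \<Rightarrow> 'm vfield) \<Rightarrow>
    'm vfield \<Rightarrow> 'm vfield \<Rightarrow> 'm vfield" where
  "cov_deriv11 D F X Y = D X (F Y) - F (D X Y)"

definition ext_deriv :: "('m vfield \<Rightarrow> 'm \<Rightarrow> real) \<Rightarrow> 'm vfield \<Rightarrow> 'm vfield \<Rightarrow> 'm \<Rightarrow> real" where
  "ext_deriv \<eta> X Y = (\<lambda>p. (act X (\<eta> Y) p - act Y (\<eta> X) p - \<eta> (lie_bracket X Y) p) / 2)"

definition nijenhuis :: "('m vfield \<Rightarrow> 'm vfield) \<Rightarrow> 'm vfield \<Rightarrow> 'm vfield \<Rightarrow> 'm vfield" where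
  "nijenhuis \<phi> X Y = \<phi> (\<phi> (lie_bracket X Y)) + lie_bracket (\<phi> X) (\<phi> Y)
     - \<phi> (lie_bracket (\<phi> X) Y) - \<phi> (lie_bracket X (\<phi> Y))"

section \<open>Weak almost contact metric structures\<close>

text \<open>The identities after the \<open>\<phi>\<close>-invariance of \<open>ker \<eta>\<close> are standing properties of these structures.
  They do not all follow from the conditions before them: composing \<open>\<phi>\<close> with an orthogonal
  endomorphism of \<open>ker \<eta>\<close> preserves the latter but may destroy skew-symmetry.\<close>

definition weak_almost_contact_metric ::
  "('m::topological_space, 'e::euclidean_space) chart set \<Rightarrow>
    ('m vfield \<Rightarrow> 'm vfield) \<Rightarrow> ('m vfield \<Rightarrow> 'm vfield) \<Rightarrow> 'm vfield \<Rightarrow>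
    ('m vfield \<Rightarrow> 'm \<Rightarrow> real) \<Rightarrow> ('m vfield \<Rightarrow> 'm vfield \<Rightarrow> 'm \<Rightarrow> real) \<Rightarrow> bool" where
  "weak_almost_contact_metric A \<phi> Q \<xi> \<eta> g \<longleftrightarrow>
     tensor11 A \<phi> \<and> tensor11 A Q \<and> bij_betw Q (vector_fields A) (vector_fields A) \<and>
     \<xi> \<in> vector_fields A \<and> one_form A \<eta> \<and> riemannian_metric A g \<and> \<eta> \<xi> = 1 \<and>
     (\<forall>X\<in>vector_fields A. \<forall>Y\<in>vector_fields A. g (\<phi> X) (\<phi> Y) = g X (Q Y) - \<eta> X * \<eta> Y) \<and>
     (\<forall>X\<in>vector_fields A. \<eta> X = 0 \<longrightarrow> \<eta> (\<phi> X) = 0) \<and>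
     \<phi> \<xi> = 0 \<and>
     (\<forall>X\<in>vector_fields A. \<eta> (\<phi> X) = 0) \<and>
     (\<forall>X\<in>vector_fields A. \<eta> (Q X) = \<eta> X) \<and>
     (\<forall>X\<in>vector_fields A. Q (\<phi> X) = \<phi> (Q X)) \<and>
     (\<forall>X\<in>vector_fields A. \<forall>Y\<in>vector_fields A. g (\<phi> X) Y = - g X (\<phi> Y)) \<and>
     (\<forall>X\<in>vector_fields A. \<forall>Y\<in>vector_fields A. g (Q X) Y = g X (Q Y)) \<and>
     (\<forall>X\<in>vector_fields A. \<forall>p. X p \<noteq> 0 \<longrightarrow> g X (Q X) p > 0) \<and>
     (\<forall>X\<in>vector_fields A. \<eta> X = g \<xi> X)"

definition almost_contact_metric ::
  "('m::topological_space, 'e::euclidean_space) chart set \<Rightarrow> ('m vfield \<Rightarrow> 'm vfield) \<Rightarrow>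
    'm vfield \<Rightarrow> ('m vfield \<Rightarrow> 'm \<Rightarrow> real) \<Rightarrow> ('m vfield \<Rightarrow> 'm vfield \<Rightarrow> 'm \<Rightarrow> real) \<Rightarrow> bool" where
  "almost_contact_metric A \<phi> \<xi> \<eta> g \<longleftrightarrow> weak_almost_contact_metric A \<phi> (\<lambda>X. X) \<xi> \<eta> g"

definition sasakian ::
  "('m::topological_space, 'e::euclidean_space) chart set \<Rightarrow> ('m vfield \<Rightarrow> 'm vfield) \<Rightarrow>
    'm vfield \<Rightarrow> ('m vfield \<Rightarrow> 'm \<Rightarrow> real) \<Rightarrow> ('m vfield \<Rightarrow> 'm vfield \<Rightarrow> 'm \<Rightarrow> real) \<Rightarrow> bool" where
  "sasakian A \<phi> \<xi> \<eta> g \<longleftrightarrow> almost_contact_metric A \<phi> \<xi> \<eta> g \<and>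
     (\<forall>X\<in>vector_fields A. \<forall>Y\<in>vector_fields A. ext_deriv \<eta> X Y = g X (\<phi> Y)) \<and>
     (\<forall>X\<in>vector_fields A. \<forall>Y\<in>vector_fields A.
        nijenhuis \<phi> X Y + (2 * ext_deriv \<eta> X Y) \<cdot> \<xi> = 0)"

end

theory Submission
  imports Defs
begin

text \<open>
  Each of the two hypotheses on covariant derivatives constrains \<open>\<nabla>\<xi>\<close>, and together they force
  \<open>Q = id\<close>. Evaluating the first one at \<open>Y = \<xi>\<close>, where \<open>\<phi> \<xi> = 0\<close>, gives
  \<open>\<phi> (\<nabla>\<^sub>X \<xi>) = X - \<eta>(X) \<xi>\<close> (lemma \<open>phi_D_xi\<close>); since \<open>\<phi>\<^sup>2 = - Q + \<eta> \<otimes> \<xi>\<close>, this says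
  \<open>Q (\<nabla>\<^sub>X \<xi>) = - \<phi> X\<close> (lemma \<open>Q_D_xi\<close>). The second one is only assumed on \<open>ker \<eta>\<close>, but its
  \<open>\<xi>\<close>-component still carries information: because \<open>g(\<xi>, \<nabla>\<^sub>X Y) = - g(\<nabla>\<^sub>X \<xi>, Y)\<close> for \<open>Y \<in> ker \<eta>\<close>, it
  reads \<open>g(\<nabla>\<^sub>X \<xi>, Q Y) = g(\<nabla>\<^sub>X \<xi>, Y)\<close>. The choice \<open>Y = Q W - W\<close> with \<open>W = \<nabla>\<^sub>X \<xi>\<close> yields
  \<open>|Q W - W|\<^sup>2 = 0\<close>, so \<open>\<nabla>\<^sub>X \<xi>\<close> is fixed by \<open>Q\<close> (lemma \<open>Q_fixes_D_xi\<close>). Hence \<open>\<nabla>\<^sub>X \<xi> = - \<phi> X\<close>, and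
  applying \<open>\<phi>\<close> again gives \<open>X - \<eta>(X) \<xi> = - \<phi>\<^sup>2 X = Q X - \<eta>(X) \<xi>\<close>.

  The Sasakian conditions are then computations with a torsion-free metric connection:
  \<open>d\<eta>\<close> is the skew part of \<open>\<nabla>\<xi> = - \<phi>\<close> (lemma \<open>ext_deriv_metric_dual\<close>), and \<open>[\<phi>, \<phi>]\<close> is an
  expression in \<open>\<nabla>\<phi>\<close> (lemma \<open>nijenhuis_cov_deriv\<close>), into which the first hypothesis is substituted.

  All of this takes place in the module of vector fields over the ring of smooth functions. The
  atlas enters in showing that this is a ring and a module: the images of its charts are open,
  so smoothness of sums and products can be read off from derivatives in coordinates.
\<close>

section \<open>The ring of smooth functions\<close>

text \<open>On an open set a function may be replaced by one that agrees with it there; this is what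
  allows derivatives to be rewritten by differentiation rules valid only on the set.\<close>

lemma Ck_on_cong:
  assumes "open S" and "\<And>x. x \<in> S \<Longrightarrow> f x = h x" and "Ck_on k S f"
  shows "Ck_on k S h"
  using assms(2,3)
proof (induction k arbitrary: f h)
  case 0
  then show ?case by (simp cong: continuous_on_cong)
next
  case (Suc k)
  have deriv: "(h has_derivative frechet_derivative f (at x)) (at x)" if "x \<in> S" for x
    using Suc.prems that assms(1)
    by (auto intro: has_derivative_transform_within_open[of f] simp: frechet_derivative_works)
  then have "frechet_derivative h (at x) = frechet_derivative f (at x)" if "x \<in> S" for x
    using that by (metis frechet_derivative_at)
  then have "Ck_on k S (\<lambda>x. frechet_derivative h (at x) v)" for v
    using Suc.prems by (auto intro: Suc.IH[of "\<lambda>x. frechet_derivative f (at x) v"])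
  then show ?case
    using deriv by (auto simp: differentiable_def)
qed

lemma Ck_on_SucD: "Ck_on (Suc k) S f \<Longrightarrow> Ck_on k S f"
proof (induction k arbitrary: f)
  case 0
  then show ?case
    by (auto intro!: continuous_at_imp_continuous_on differentiable_imp_continuous_within)
next
  case (Suc k)
  then show ?case by (metis Ck_on.simps(2))
qed

lemma Ck_on_const: "Ck_on k S (\<lambda>x. c)"
  by (induction k arbitrary: c) auto

lemma Ck_on_add:
  assumes "open S"
  shows "Ck_on k S f \<Longrightarrow> Ck_on k S h \<Longrightarrow> Ck_on k S (\<lambda>x. f x + h x)"
proof (induction k arbitrary: f h)
  case 0
  then show ?case by (simp add: continuous_on_add)
next
  case (Suc k)
  have "frechet_derivative f (at x) v + frechet_derivative h (at x) v
      = frechet_derivative (\<lambda>x. f x + h x) (at x) v" if "x \<in> S" for x v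
    using Suc.prems that
    by (subst frechet_derivative_at[symmetric, OF has_derivative_add])
      (auto simp: frechet_derivative_works)
  moreover have "Ck_on k S (\<lambda>x. frechet_derivative f (at x) v + frechet_derivative h (at x) v)" for v
    using Suc by simp
  ultimately have "Ck_on k S (\<lambda>x. frechet_derivative (\<lambda>x. f x + h x) (at x) v)" for v
    by (rule Ck_on_cong[OF assms])
  then show ?case using Suc.prems by auto
qed

lemma Ck_on_mult:
  fixes f h :: "'a::real_normed_vector \<Rightarrow> real"
  assumes "open S"
  shows "Ck_on k S f \<Longrightarrow> Ck_on k S h \<Longrightarrow> Ck_on k S (\<lambda>x. f x * h x)"
proof (induction k arbitrary: f h)
  case 0
  then show ?case by (simp add: continuous_on_mult)
next
  case (Suc k)
  have "f x * frechet_derivative h (at x) v + frechet_derivative f (at x) v * h x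
      = frechet_derivative (\<lambda>x. f x * h x) (at x) v" if "x \<in> S" for x v
    using Suc.prems that
    by (subst frechet_derivative_at[symmetric, OF has_derivative_mult])
      (auto simp: frechet_derivative_works)
  moreover have "Ck_on k S
      (\<lambda>x. f x * frechet_derivative h (at x) v + frechet_derivative f (at x) v * h x)" for v
    using Suc.prems Ck_on_SucD[OF Suc.prems(1)] Ck_on_SucD[OF Suc.prems(2)]
    by (simp add: Ck_on_add[OF assms] Suc.IH)
  ultimately have "Ck_on k S (\<lambda>x. frechet_derivative (\<lambda>x. f x * h x) (at x) v)" for v
    by (rule Ck_on_cong[OF assms])
  then show ?case using Suc.prems by auto
qed

locale smooth_manifold =
  fixes A :: "('m::{t2_space, second_countable_topology}, 'e::euclidean_space) chart set"
  assumes atlas: "smooth_atlas A"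
begin

abbreviation "V \<equiv> vector_fields A"
abbreviation "C \<equiv> smooth_functions A"

lemma open_chart_image: "(U, x) \<in> A \<Longrightarrow> open (x ` U)"
  using atlas by (auto simp: smooth_atlas_def is_chart_def)

lemma smooth_const: "(\<lambda>p. c) \<in> C"
  by (auto simp: smooth_functions_def smooth_on_def comp_def Ck_on_const)

lemma smooth_add: "f \<in> C \<Longrightarrow> h \<in> C \<Longrightarrow> f + h \<in> C"
  using open_chart_image
  by (fastforce simp: smooth_functions_def smooth_on_def comp_def intro!: Ck_on_add)

lemma smooth_mult: "f \<in> C \<Longrightarrow> h \<in> C \<Longrightarrow> f * h \<in> C"
  using open_chart_image
  by (fastforce simp: smooth_functions_def smooth_on_def comp_def intro!: Ck_on_mult)

section \<open>The module of vector fields\<close>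

lemma vf_add:
  assumes "X \<in> V" "Y \<in> V"
  shows "X + Y \<in> V"
proof -
  have "(\<lambda>p. X p f + Y p f) \<in> C" if "f \<in> C" for f
    using assms that smooth_add[of "\<lambda>p. X p f" "\<lambda>p. Y p f"]
    by (auto simp: vector_fields_def plus_fun_def)
  then show ?thesis
    using assms by (auto simp: vector_fields_def tangent_space_def algebra_simps)
qed

lemma vf_scale:
  assumes "f \<in> C" "X \<in> V"
  shows "f \<cdot> X \<in> V"
proof -
  have "(\<lambda>p. f p * X p h) \<in> C" if "h \<in> C" for h
    using assms that smooth_mult[of f "\<lambda>p. X p h"]
    by (auto simp: vector_fields_def times_fun_def)
  then show ?thesis
    using assms by (auto simp: vector_fields_def tangent_space_def fscale_def algebra_simps)
qed

lemma vf_uminus: "X \<in> V \<Longrightarrow> - X \<in> V"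
  using vf_scale[OF smooth_const[of "-1"], of X]
  by (simp add: fscale_def fun_Compl_def)

lemma vf_diff: "X \<in> V \<Longrightarrow> Y \<in> V \<Longrightarrow> X - Y \<in> V"
  using vf_add[of X "- Y"] vf_uminus[of Y] by simp

lemmas vf_closed = vf_add vf_diff vf_uminus vf_scale

text \<open>A derivation kills constants, by the Leibniz rule for \<open>1 * 1\<close> and homogeneity.\<close>

lemma act_const:
  assumes "X \<in> V"
  shows "act X (\<lambda>p. c) = 0"
proof
  fix p
  have v: "X p \<in> tangent_space A p"
    using assms by (simp add: vector_fields_def)
  have "X p ((\<lambda>q. 1) * (\<lambda>q. 1)) = X p (\<lambda>q. 1) + X p (\<lambda>q. 1)"
    using v smooth_const[of 1] by (auto simp: tangent_space_def)
  then have "X p (\<lambda>q. 1) = 0"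
    by (simp add: times_fun_def)
  moreover have "\<forall>f\<in>C. X p (\<lambda>q. c * f q) = c * X p f"
    using v by (auto simp: tangent_space_def)
  from bspec[OF this smooth_const[of 1]] have "X p (\<lambda>q. c * 1) = c * X p (\<lambda>q. 1)" .
  ultimately show "act X (\<lambda>p. c) p = 0 p"
    by (simp add: act_def)
qed

lemma tensor11_closed: "tensor11 A F \<Longrightarrow> X \<in> V \<Longrightarrow> F X \<in> V"
  by (simp add: tensor11_def)

lemma tensor11_diff:
  assumes "tensor11 A F" "X \<in> V" "Y \<in> V"
  shows "F (X - Y) = F X - F Y"
proof -
  have "F ((X - Y) + Y) = F (X - Y) + F Y"
    using assms vf_diff unfolding tensor11_def by blast
  then show ?thesis by (simp add: algebra_simps)
qed

lemma tensor11_uminus: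
  assumes "tensor11 A F" "X \<in> V"
  shows "F (- X) = - F X"
  using tensor11_diff[OF assms(1) vf_diff[OF assms(2,2)] assms(2)] tensor11_diff[OF assms assms(2)]
  by simp

lemma tensor11_scale: "tensor11 A F \<Longrightarrow> f \<in> C \<Longrightarrow> X \<in> V \<Longrightarrow> F (f \<cdot> X) = f \<cdot> F X"
  by (simp add: tensor11_def)

lemma one_form_diff:
  assumes "one_form A \<omega>" "X \<in> V" "Y \<in> V"
  shows "\<omega> (X - Y) = \<omega> X - \<omega> Y"
proof -
  have "\<omega> ((X - Y) + Y) = \<omega> (X - Y) + \<omega> Y"
    using assms vf_diff unfolding one_form_def by blast
  then show ?thesis by (simp add: algebra_simps)
qed

lemma one_form_uminus:
  assumes "one_form A \<omega>" "X \<in> V"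
  shows "\<omega> (- X) = - \<omega> X"
  using one_form_diff[OF assms(1) vf_diff[OF assms(2,2)] assms(2)] one_form_diff[OF assms assms(2)]
  by simp

end

section \<open>Riemannian manifolds and their Levi-Civita connection\<close>

locale riemannian_manifold = smooth_manifold A
  for A :: "('m::{t2_space, second_countable_topology}, 'e::euclidean_space) chart set" +
  fixes g :: "'m vfield \<Rightarrow> 'm vfield \<Rightarrow> 'm \<Rightarrow> real"
    and D :: "'m vfield \<Rightarrow> 'm vfield \<Rightarrow> 'm vfield"
  assumes metric: "riemannian_metric A g" and LC: "levi_civita A g D"
begin

lemma metric_one_form: "X \<in> V \<Longrightarrow> one_form A (g X)"
  using metric by (simp add: riemannian_metric_def)

lemma metric_sym: "X \<in> V \<Longrightarrow> Y \<in> V \<Longrightarrow> g X Y = g Y X"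
  using metric by (simp add: riemannian_metric_def)

lemma metric_smooth: "X \<in> V \<Longrightarrow> Y \<in> V \<Longrightarrow> g X Y \<in> C"
  using metric_one_form by (simp add: one_form_def)

lemma metric_scale_right: "X \<in> V \<Longrightarrow> Y \<in> V \<Longrightarrow> f \<in> C \<Longrightarrow> g X (f \<cdot> Y) = f * g X Y"
  using metric_one_form by (simp add: one_form_def)

lemmas metric_diff_right = one_form_diff[OF metric_one_form]

lemma metric_diff_left: "X \<in> V \<Longrightarrow> Y \<in> V \<Longrightarrow> Z \<in> V \<Longrightarrow> g (X - Y) Z = g X Z - g Y Z"
  by (simp add: metric_sym[of _ Z] vf_diff metric_diff_right)

lemma metric_definite:
  assumes "X \<in> V" "g X X = 0"
  shows "X = 0"
proof (rule ext, rule ccontr)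
  fix p assume "X p \<noteq> 0 p"
  then have "g X X p > 0"
    using metric assms(1) by (simp add: riemannian_metric_def)
  then show False using assms(2) by simp
qed

lemma metric_nondegenerate:
  assumes "X \<in> V" "Y \<in> V" and "\<And>Z. Z \<in> V \<Longrightarrow> g Z X = g Z Y"
  shows "X = Y"
proof -
  have "g (X - Y) (X - Y) = 0"
    using assms by (simp add: metric_diff_right vf_diff)
  then show ?thesis
    using metric_definite[of "X - Y"] assms vf_diff by simp
qed

lemma D_closed: "X \<in> V \<Longrightarrow> Y \<in> V \<Longrightarrow> D X Y \<in> V"
  using LC by (simp add: levi_civita_def connection_def tensor11_def)

lemma D_diff:
  assumes "X \<in> V" "Y \<in> V" "Z \<in> V"
  shows "D X (Y - Z) = D X Y - D X Z"
proof -
  have "D X ((Y - Z) + Z) = D X (Y - Z) + D X Z"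
    using LC assms vf_diff unfolding levi_civita_def connection_def by blast
  then show ?thesis by (simp add: algebra_simps)
qed

lemma D_zero: "X \<in> V \<Longrightarrow> D X 0 = 0"
  using D_diff[of X X X] by simp

lemma torsion_free: "X \<in> V \<Longrightarrow> Y \<in> V \<Longrightarrow> lie_bracket X Y = D X Y - D Y X"
  using LC by (simp add: levi_civita_def)

lemma metric_compatible:
  "X \<in> V \<Longrightarrow> Y \<in> V \<Longrightarrow> Z \<in> V \<Longrightarrow> act X (g Y Z) = g (D X Y) Z + g Y (D X Z)"
  using LC by (simp add: levi_civita_def)

text \<open>Since \<open>\<nabla>\<close> is metric and torsion-free, the second derivatives hidden in
  \<open>d\<eta>\<close> cancel and only the skew part of \<open>\<nabla>\<xi>\<close> remains.\<close>

lemma ext_deriv_metric_dual: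
  assumes "X \<in> V" "Y \<in> V" "\<xi> \<in> V" and dual: "\<And>Z. Z \<in> V \<Longrightarrow> \<eta> Z = g \<xi> Z"
  shows "ext_deriv \<eta> X Y = (\<lambda>p. (g (D X \<xi>) Y p - g (D Y \<xi>) X p) / 2)"
  using assms
  by (simp add: ext_deriv_def metric_compatible torsion_free D_closed vf_diff metric_diff_right)

text \<open>Expanding each bracket by torsion-freeness and each \<open>\<nabla>(\<phi> Y)\<close> by the product rule, all terms
  with undifferentiated \<open>\<phi>\<close> cancel.\<close>

lemma nijenhuis_cov_deriv:
  assumes F: "tensor11 A F" and X: "X \<in> V" and Y: "Y \<in> V"
  shows "nijenhuis F X Y = cov_deriv11 D F (F X) Y - cov_deriv11 D F (F Y) X
           + F (cov_deriv11 D F Y X) - F (cov_deriv11 D F X Y)"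
  using X Y
  by (simp add: nijenhuis_def cov_deriv11_def torsion_free tensor11_diff[OF F]
      tensor11_closed[OF F] D_closed vf_diff algebra_simps)

end

section \<open>Weak almost contact metric structures with the Sasakian \<open>\<nabla>\<phi>\<close>\<close>

locale weak_nabla_sasakian = riemannian_manifold A g D
  for A :: "('m::{t2_space, second_countable_topology}, 'e::euclidean_space) chart set"
    and g :: "'m vfield \<Rightarrow> 'm vfield \<Rightarrow> 'm \<Rightarrow> real"
    and D :: "'m vfield \<Rightarrow> 'm vfield \<Rightarrow> 'm vfield" +
  fixes \<phi> Q :: "'m vfield \<Rightarrow> 'm vfield" and \<xi> :: "'m vfield" and \<eta> :: "'m vfield \<Rightarrow> 'm \<Rightarrow> real"
  assumes weak: "weak_almost_contact_metric A \<phi> Q \<xi> \<eta> g"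
    and nabla_phi: "\<And>X Y. X \<in> V \<Longrightarrow> Y \<in> V \<Longrightarrow> cov_deriv11 D \<phi> X Y = g X Y \<cdot> \<xi> - \<eta> Y \<cdot> X"
begin

lemma
  shows phi: "tensor11 A \<phi>" and Q: "tensor11 A Q" and xi: "\<xi> \<in> V" and eta: "one_form A \<eta>"
    and eta_xi: "\<eta> \<xi> = 1" and phi_xi: "\<phi> \<xi> = 0"
    and phi_phi_metric: "\<And>X Y. X \<in> V \<Longrightarrow> Y \<in> V \<Longrightarrow> g (\<phi> X) (\<phi> Y) = g X (Q Y) - \<eta> X * \<eta> Y"
    and eta_phi: "\<And>X. X \<in> V \<Longrightarrow> \<eta> (\<phi> X) = 0"
    and eta_Q: "\<And>X. X \<in> V \<Longrightarrow> \<eta> (Q X) = \<eta> X"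
    and phi_skew: "\<And>X Y. X \<in> V \<Longrightarrow> Y \<in> V \<Longrightarrow> g (\<phi> X) Y = - g X (\<phi> Y)"
    and Q_self_adjoint: "\<And>X Y. X \<in> V \<Longrightarrow> Y \<in> V \<Longrightarrow> g (Q X) Y = g X (Q Y)"
    and eta_dual: "\<And>X. X \<in> V \<Longrightarrow> \<eta> X = g \<xi> X"
  using weak by (simp_all add: weak_almost_contact_metric_def)

lemmas closed = tensor11_closed[OF phi] tensor11_closed[OF Q] xi D_closed vf_closed

lemma eta_smooth: "X \<in> V \<Longrightarrow> \<eta> X \<in> C"
  using eta by (simp add: one_form_def)

text \<open>Skew-symmetry turns the compatibility of \<open>\<phi>\<close> with \<open>g\<close> into \<open>g(Z, \<phi>\<^sup>2 X) = g(Z, \<eta>(X) \<xi> - Q X)\<close>.\<close>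

lemma phi_phi:
  assumes "X \<in> V"
  shows "\<phi> (\<phi> X) = \<eta> X \<cdot> \<xi> - Q X"
proof (rule metric_nondegenerate)
  fix Z assume Z: "Z \<in> V"
  have "g Z (\<phi> (\<phi> X)) = \<eta> Z * \<eta> X - g Z (Q X)"
    using phi_skew[OF Z closed(1)[OF assms]] phi_phi_metric[OF Z assms] by (simp add: algebra_simps)
  also have "\<dots> = \<eta> X * g Z \<xi> - g Z (Q X)"
    using Z by (simp add: eta_dual metric_sym[of \<xi> Z] xi mult.commute)
  finally show "g Z (\<phi> (\<phi> X)) = g Z (\<eta> X \<cdot> \<xi> - Q X)"
    using assms Z by (simp add: metric_diff_right metric_scale_right closed eta_smooth)
qed (use assms in \<open>simp_all add: closed eta_smooth\<close>)

text \<open>The unit field \<open>\<xi>\<close> has constant length.\<close>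

lemma eta_D_xi:
  assumes "X \<in> V"
  shows "\<eta> (D X \<xi>) = 0"
proof -
  have "act X (g \<xi> \<xi>) = 0"
    using act_const[OF assms, of 1] eta_xi by (simp add: eta_dual[OF xi] one_fun_def)
  then have "g \<xi> (D X \<xi>) + g \<xi> (D X \<xi>) = 0"
    using assms by (simp add: metric_compatible metric_sym[of "D X \<xi>" \<xi>] closed)
  then show ?thesis
    using assms by (simp add: eta_dual closed fun_eq_iff)
qed

lemma eta_D_kernel:
  assumes "X \<in> V" "Y \<in> V" "\<eta> Y = 0"
  shows "\<eta> (D X Y) = - g (D X \<xi>) Y"
proof -
  have "act X (g \<xi> Y) = 0"
    using act_const[OF assms(1), of 0] assms by (simp add: eta_dual[symmetric] zero_fun_def)
  then show ?thesis
    using assms by (simp add: metric_compatible eta_dual closed eq_neg_iff_add_eq_0 add.commute)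
qed

text \<open>This is the hypothesis on \<open>\<nabla>\<phi>\<close> at \<open>Y = \<xi>\<close>, where \<open>\<phi> Y\<close> vanishes identically.\<close>

lemma phi_D_xi:
  assumes "X \<in> V"
  shows "\<phi> (D X \<xi>) = X - \<eta> X \<cdot> \<xi>"
proof -
  have "- \<phi> (D X \<xi>) = g X \<xi> \<cdot> \<xi> - \<eta> \<xi> \<cdot> X"
    using nabla_phi[OF assms xi] assms by (simp add: cov_deriv11_def phi_xi D_zero)
  then show ?thesis
    using assms
    by (simp add: eta_xi eta_dual[OF assms] metric_sym[of \<xi> X] xi fscale_def fun_eq_iff algebra_simps)
qed

lemma Q_D_xi:
  assumes "X \<in> V"
  shows "Q (D X \<xi>) = - \<phi> X"
proof -
  have "\<phi> (\<phi> (D X \<xi>)) = \<phi> X"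
    using assms
    by (simp add: phi_D_xi tensor11_diff[OF phi] tensor11_scale[OF phi] phi_xi closed eta_smooth)
      (simp add: fscale_def fun_eq_iff)
  moreover have "0 \<cdot> \<xi> = 0"
    by (simp add: fscale_def fun_eq_iff)
  ultimately have "\<phi> X = - Q (D X \<xi>)"
    using phi_phi[of "D X \<xi>"] assms by (simp add: eta_D_xi closed)
  then show ?thesis by simp
qed

end

locale weak_nabla_sasakian_parallel = weak_nabla_sasakian +
  assumes parallel:
    "\<And>X Y. X \<in> V \<Longrightarrow> Y \<in> V \<Longrightarrow> \<eta> Y = 0 \<Longrightarrow> cov_deriv11 D (\<lambda>Z. Q Z - Z) X Y = 0"
begin

text \<open>The \<open>\<xi>\<close>-component of the parallelism of \<open>Q - id\<close> on \<open>ker \<eta>\<close> says that \<open>Q W - W\<close>,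
  where \<open>W = \<nabla>\<^sub>X \<xi>\<close>, is orthogonal to \<open>ker \<eta>\<close>; but it also lies in \<open>ker \<eta>\<close>, because \<open>\<eta> \<circ> Q = \<eta>\<close>.\<close>

lemma Q_fixes_D_xi:
  assumes X: "X \<in> V"
  shows "Q (D X \<xi>) = D X \<xi>"
proof -
  define W where "W = D X \<xi>"
  define Y where "Y = Q W - W"
  have W: "W \<in> V" and Y: "Y \<in> V"
    using X by (simp_all add: W_def Y_def closed)
  have ker: "\<eta> Y = 0"
    using W by (simp add: Y_def one_form_diff[OF eta] closed eta_Q)
  have "D X (Q Y) = Q (D X Y)"
    using parallel[OF X Y ker] X Y by (simp add: cov_deriv11_def D_diff closed)
  then have "\<eta> (D X (Q Y)) = \<eta> (D X Y)"
    using X Y by (simp add: closed eta_Q)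
  then have "g W (Q Y) = g W Y"
    using X Y ker by (simp add: eta_D_kernel closed eta_Q W_def)
  then have "g Y Y = 0"
    using W Y by (simp add: Y_def metric_diff_left[of "Q W" W "Q W - W"] closed Q_self_adjoint)
  then have "Y = 0"
    using Y by (rule metric_definite[rotated])
  then show ?thesis by (simp add: Y_def W_def)
qed

lemma D_xi:
  assumes "X \<in> V"
  shows "D X \<xi> = - \<phi> X"
  using Q_fixes_D_xi[OF assms] Q_D_xi[OF assms] by simp

lemma Q_eq_id:
  assumes X: "X \<in> V"
  shows "Q X = X"
proof -
  have "\<phi> (D X \<xi>) = - \<phi> (\<phi> X)"
    using X D_xi[OF assms] by (simp add: tensor11_uminus[OF phi] closed)
  then show ?thesis
    using X by (simp add: phi_D_xi phi_phi)
qed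

section \<open>The Sasakian conditions\<close>

lemma ext_deriv_eta:
  assumes X: "X \<in> V" and Y: "Y \<in> V"
  shows "ext_deriv \<eta> X Y = g X (\<phi> Y)"
proof -
  have "g (D X \<xi>) Y = g X (\<phi> Y)" "g (D Y \<xi>) X = - g X (\<phi> Y)"
    using X Y phi_skew[OF X Y]
    by (simp_all add: D_xi metric_sym[of "- \<phi> _"] one_form_uminus[OF metric_one_form] closed
        metric_sym[of Y "\<phi> X"])
  then show ?thesis
    using X Y by (simp add: ext_deriv_metric_dual[OF X Y xi, of \<eta>] eta_dual)
qed

text \<open>The terms of \<open>\<nabla>\<phi>\<close> along \<open>\<phi> X\<close> and \<open>\<phi> Y\<close> cancel between the two pairs in
  \<open>nijenhuis_cov_deriv\<close>, since \<open>\<phi>\<close> kills \<open>\<xi>\<close>. What survives is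
  \<open>(g(\<phi> X, Y) - g(\<phi> Y, X)) \<xi> = - 2 g(X, \<phi> Y) \<xi>\<close>, by skew-symmetry of \<open>\<phi>\<close>.\<close>

lemma normality:
  assumes X: "X \<in> V" and Y: "Y \<in> V"
  shows "nijenhuis \<phi> X Y + (2 * ext_deriv \<eta> X Y) \<cdot> \<xi> = 0"
proof -
  have phi_cov: "\<phi> (cov_deriv11 D \<phi> Z W) = - (\<eta> W \<cdot> \<phi> Z)" if "Z \<in> V" "W \<in> V" for Z W
    using that
    by (simp add: nabla_phi tensor11_diff[OF phi] tensor11_scale[OF phi] phi_xi closed
        eta_smooth metric_smooth) (simp add: fscale_def fun_eq_iff)
  have "nijenhuis \<phi> X Y = (g (\<phi> X) Y \<cdot> \<xi> - \<eta> Y \<cdot> \<phi> X)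
      - (g (\<phi> Y) X \<cdot> \<xi> - \<eta> X \<cdot> \<phi> Y) + - (\<eta> X \<cdot> \<phi> Y) - - (\<eta> Y \<cdot> \<phi> X)"
    unfolding nijenhuis_cov_deriv[OF phi X Y] phi_cov[OF X Y] phi_cov[OF Y X]
    using X Y by (simp add: nabla_phi closed)
  moreover have "g (\<phi> X) Y = - g X (\<phi> Y)" "g (\<phi> Y) X = g X (\<phi> Y)"
    using phi_skew[OF X Y] metric_sym[OF closed(1)[OF Y] X] by simp_all
  ultimately show ?thesis
    using X Y by (simp add: ext_deriv_eta fscale_def fun_eq_iff algebra_simps)
qed

lemma almost_contact_metric: "almost_contact_metric A \<phi> \<xi> \<eta> g"
  using weak Q_eq_id
  unfolding almost_contact_metric_def weak_almost_contact_metric_def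
  by (auto simp: tensor11_def closed bij_betw_def)

end

theorem theorem2:
  fixes A :: "('m::{t2_space, second_countable_topology}, 'e::euclidean_space) chart set"
    and n :: nat
    and \<phi> Q :: "'m vfield \<Rightarrow> 'm vfield"
    and \<xi> :: "'m vfield"
    and \<eta> :: "'m vfield \<Rightarrow> 'm \<Rightarrow> real"
    and g :: "'m vfield \<Rightarrow> 'm vfield \<Rightarrow> 'm \<Rightarrow> real"
    and D :: "'m vfield \<Rightarrow> 'm vfield \<Rightarrow> 'm vfield"
  assumes "smooth_atlas A" and "DIM('e) = 2 * n + 1" and "n > 0"
    and "weak_almost_contact_metric A \<phi> Q \<xi> \<eta> g"
    and "levi_civita A g D"
    and "\<And>X Y. X \<in> vector_fields A \<Longrightarrow> Y \<in> vector_fields A \<Longrightarrow>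
           cov_deriv11 D \<phi> X Y = g X Y \<cdot> \<xi> - \<eta> Y \<cdot> X"
    and "\<And>X Y. X \<in> vector_fields A \<Longrightarrow> Y \<in> vector_fields A \<Longrightarrow> \<eta> Y = 0 \<Longrightarrow>
           cov_deriv11 D (\<lambda>Z. Q Z - Z) X Y = 0"
  shows "(\<forall>X\<in>vector_fields A. Q X = X) \<and> sasakian A \<phi> \<xi> \<eta> g"
proof -
  interpret weak_nabla_sasakian_parallel A g D \<phi> Q \<xi> \<eta>
    using assms(1,4-7) by unfold_locales (simp_all add: weak_almost_contact_metric_def)
  show ?thesis
    unfolding sasakian_def
    using Q_eq_id almost_contact_metric ext_deriv_eta normality by blast
qed

end
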